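(* Let $q$ be an odd prime power, $d\ge 3$, $E\subset \mathbb F_q^d$ nonempty, $\lambda\in \mathbb{F}_q\setminus \{0, 1,-1\}$, and $0<N<q$ a real number. (a) If $d\ge 3$ is odd, then $$|\mathcal{T}_1(X_\pi, E,N)| \le \frac{Nq^{d-1}}{(q-N)|E|} + \frac{Nq^{\frac{d-1}{2}}}{q-N}.$$ (b) If $d\ge 4$ is even and $\eta\left( (-1)^{\frac{d}{2}} (\lambda^2-1) \right)=-1$, then $$|\mathcal{T}_1(X_\pi, E,N)| \le \frac{Nq^{d-1}}{(q-N)|E|} + \frac{Nq^{\frac{d-2}{2}}}{q-N}.$$ (c) If $d\ge 4$ is even and $\eta\left( (-1)^{\frac{d}{2}} (\lambda^2-1) \right)=1$, then $$|\mathcal{T}_1(X_\pi, E,N)|\le \frac{Nq^{d-1}}{(q-N)|E|} + \frac{N \left(q^{\frac{d}{2}} -q^{\frac{d-2}{2}}\right)}{q-N}.$$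
   Context: $\mathbb F_q$ is the finite field with $q$ elements. $\eta$ is the quadratic character of $\mathbb F_q$: $\eta(t)=1$ if $t$ is a nonzero square, $\eta(0)=0$, $\eta(t)=-1$ otherwise. For $\mathbf x\in\mathbb F_q^d$, $\|\mathbf x\|=x_1^2+\cdots+x_d^2$, and $\mathbf x\cdot\mathbf y=\sum_i x_iy_i$. $S^{d-1}=\{\mathbf x\in\mathbb F_q^d:\|\mathbf x\|=1\}$, $\pi=\{\mathbf x\in\mathbb F_q^d: x_d=\lambda\}$. $X_\pi$ is the set of lines through the origin (one-dimensional linear subspaces of $\mathbb F_q^d$) that contain a nonzero element of $\pi\cap S^{d-1}$. For a linear subspace $V$, $V^\perp=\{\mathbf x\in\mathbb F_q^d:\mathbf x\cdot\mathbf y=0\ \forall \mathbf y\in V\}$, and $\pi_V(E)=\{\mathbf x+V^\perp:\mathbf x\in\mathbb F_q^d,\ (\mathbf x+V^\perp)\cap E\neq\emptyset\}$, a set of cosets. $\mathcal T_1(X_\pi,E,N)=\{V\in X_\pi: |\pi_V(E)|\le N\}$. *)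

theory Defs
  imports "HOL-Analysis.Analysis"
begin

text \<open>
  The field with \<open>q\<close> elements is a type \<open>'a :: {field, finite}\<close>, so that \<open>q = CARD('a)\<close>, and the
  \<open>d\<close>-dimensional space over it is \<open>'a ^ 'd\<close>, so that \<open>d = CARD('d)\<close>. A finite index type has no
  last element; the coordinate written \<open>x\<^sub>d\<close> on paper is therefore an explicit index \<open>k :: 'd\<close>.
\<close>

definition quadratic_character :: "'a::field \<Rightarrow> int" where
  "quadratic_character t = (if t = 0 then 0 else if \<exists>s. t = s\<^sup>2 then 1 else -1)"

definition norm_form :: "'a::field ^ 'd \<Rightarrow> 'a" where
  "norm_form x = (\<Sum>i\<in>UNIV. (x $ i)\<^sup>2)"

definition unit_sphere :: "('a::field ^ 'd) set" where
  "unit_sphere = {x. norm_form x = 1}"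

definition coord_plane :: "'d \<Rightarrow> 'a \<Rightarrow> ('a::field ^ 'd) set" where
  "coord_plane k c = {x. x $ k = c}"

definition lines_through_section :: "'d \<Rightarrow> 'a \<Rightarrow> ('a::field ^ 'd) set set" where
  "lines_through_section k c =
     {V. vec.subspace V \<and> vec.dim V = 1 \<and> (\<exists>x\<in>V. x \<noteq> 0 \<and> x \<in> coord_plane k c \<inter> unit_sphere)}"

definition perp :: "('a::field ^ 'd) set \<Rightarrow> ('a ^ 'd) set" where
  "perp V = {x. \<forall>y\<in>V. scalar_product x y = 0}"

definition coset_projection :: "('a::field ^ 'd) set \<Rightarrow> ('a ^ 'd) set \<Rightarrow> ('a ^ 'd) set set" where
  "coset_projection V E = {(\<lambda>y. x + y) ` perp V | x. (\<lambda>y. x + y) ` perp V \<inter> E \<noteq> {}}"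

definition exceptional_set ::
  "('a::field ^ 'd) set set \<Rightarrow> ('a ^ 'd) set \<Rightarrow> real \<Rightarrow> ('a ^ 'd) set set" where
  "exceptional_set X E N = {V \<in> X. real (card (coset_projection V E)) \<le> N}"

end

theory Submission
  imports Defs "HOL-Number_Theory.Residues"
begin

text \<open>
  The lines of \<open>X\<^sub>\<pi>\<close> lie in the cone \<open>C\<close> of zeros of the nondegenerate diagonal form
  \<open>\<parallel>x\<parallel> - x\<^sub>d\<^sup>2 / \<lambda>\<^sup>2\<close>. For \<open>x \<noteq> 0\<close> let \<open>f x\<close> be the number of pairs \<open>(y, z)\<close> in \<open>E \<times> E\<close> with
  \<open>y \<bullet> x = z \<bullet> x\<close>. By Cauchy-Schwarz \<open>f x \<ge> |E|\<^sup>2 / q\<close> always, and \<open>f x \<ge> |E|\<^sup>2 / N\<close> on exceptional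
  lines, so the sum of \<open>f x - |E|\<^sup>2 / q\<close> over \<open>C\<close> bounds the number of exceptional lines. Exchanging
  summation, this sum is governed by the numbers of points of \<open>C\<close> in the hyperplanes \<open>m\<^sup>\<bottom>\<close>. These
  are computed without additive characters: the value distribution of a diagonal form is an
  iterated convolution of scaled copies of \<open>\<eta>\<close>, and translating along the direction dual to \<open>m\<close> relates
  the values of the form on \<open>m\<^sup>\<bottom>\<close> to those on the whole space.
\<close>

section \<open>The quadratic character of a finite field\<close>

abbreviation \<eta> :: "'a::field \<Rightarrow> int" where "\<eta> \<equiv> quadratic_character"

text \<open>The characteristic divides the order of the field, so characteristic 2 would make that
  order even.\<close>

lemma two_neq_zero:
  assumes "odd CARD('a::{field,finite})"
  shows "(2::'a) \<noteq> 0"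
proof
  assume "(2::'a) = 0"
  then have "of_nat 2 = (0::'a)" by simp
  then have "CHAR('a) dvd 2" by (simp only: of_nat_eq_0_iff_char_dvd)
  moreover have "CHAR('a) \<noteq> 1" by simp
  ultimately have "CHAR('a) = 2"
    by (metis two_is_prime_nat prime_nat_iff)
  with CHAR_dvd_CARD[where 'a='a] assms show False by simp
qed

lemma quadratic_character_0 [simp]: "\<eta> 0 = 0"
  by (simp add: quadratic_character_def)

lemma quadratic_character_square [simp]: "t \<noteq> 0 \<Longrightarrow> \<eta> (t\<^sup>2) = 1"
  by (auto simp: quadratic_character_def)

lemma quadratic_character_1 [simp]: "\<eta> 1 = 1"
  using quadratic_character_square[of 1] by simp

text \<open>Point counts are turned into character sums through this identity; the value 0 of
  \<open>\<eta>\<close> at 0 matches the single root there.\<close>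

lemma card_square_roots:
  fixes t :: "'a::{field,finite}"
  assumes "odd CARD('a)"
  shows "int (card {v. v\<^sup>2 = t}) = 1 + \<eta> t"
proof (cases "\<exists>s. t = s\<^sup>2")
  case True
  then obtain s where s: "t = s\<^sup>2" by blast
  then have roots: "{v. v\<^sup>2 = t} = {s, -s}" by (auto simp: power2_eq_iff)
  show ?thesis
  proof (cases "s = 0")
    case False
    have "s \<noteq> -s"
    proof
      assume "s = -s"
      then have "2 * s = 0" by (metis add.right_inverse mult_2)
      with False two_neq_zero[OF assms] show False by simp
    qed
    then show ?thesis using roots False by (simp add: s)
  qed (use roots s in simp)
next
  case False
  then have none: "{v. v\<^sup>2 = t} = {}" by auto
  have "t \<noteq> 0" using False by (metis zero_power2)
  then have "\<eta> t = -1" using False by (auto simp: quadratic_character_def)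
  with none show ?thesis by simp
qed

text \<open>Squaring partitions the field into fibres of size \<open>1 + \<eta> t\<close>; their
  sizes add up to the order of the field, as do the ones alone.\<close>

lemma sum_quadratic_character:
  assumes "odd CARD('a::{field,finite})"
  shows "(\<Sum>t\<in>(UNIV::'a set). \<eta> t) = 0"
proof -
  have "CARD('a) = (\<Sum>t\<in>(UNIV::'a set). card {v::'a. v\<^sup>2 = t})"
    using sum.group[of "UNIV::'a set" "UNIV::'a set" "\<lambda>v. v\<^sup>2" "\<lambda>_. 1::nat"] by simp
  then have "int CARD('a) = (\<Sum>t\<in>(UNIV::'a set). int (card {v::'a. v\<^sup>2 = t}))"
    by (metis of_nat_sum)
  then have "int CARD('a) = (\<Sum>t\<in>(UNIV::'a set). 1 + \<eta> t)"
    by (simp only: card_square_roots[OF assms])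
  then show ?thesis by (simp add: sum.distrib)
qed

lemma sum_reindex_mult:
  fixes c :: "'a::{field,finite}"
  assumes "c \<noteq> 0"
  shows "(\<Sum>t\<in>UNIV. f (c * t)) = (\<Sum>t\<in>UNIV. f t)"
  by (rule sum.reindex_bij_witness[of _ "\<lambda>t. t / c" "\<lambda>t. c * t"]) (use assms in auto)

lemma sum_reindex_minus:
  fixes w :: "'a::{field,finite}"
  shows "(\<Sum>u\<in>UNIV. f (w - u)) = (\<Sum>u\<in>UNIV. f u)"
  by (rule sum.reindex_bij_witness[of _ "\<lambda>t. w - t" "\<lambda>t. w - t"]) auto

lemma quadratic_character_square_mult:
  fixes t u :: "'a::field"
  assumes "u \<noteq> 0"
  shows "\<eta> (u\<^sup>2 * t) = \<eta> t"
proof -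
  have "(\<exists>s. u\<^sup>2 * t = s\<^sup>2) \<longleftrightarrow> (\<exists>s. t = s\<^sup>2)"
  proof
    assume "\<exists>s. u\<^sup>2 * t = s\<^sup>2"
    then obtain s where "u\<^sup>2 * t = s\<^sup>2" by blast
    then have "t = (s / u)\<^sup>2" using assms by (simp add: power_divide field_simps)
    then show "\<exists>s. t = s\<^sup>2" by blast
  qed (metis power_mult_distrib)
  then show ?thesis using assms by (simp add: quadratic_character_def)
qed

text \<open>For a nonsquare \<open>s\<close>, the sum of \<open>\<eta> (s * u) + \<eta> u\<close> over all \<open>u\<close> vanishes while no
  summand is positive, so every summand is zero.\<close>

lemma quadratic_character_mult:
  fixes s t :: "'a::{field,finite}"
  assumes "odd CARD('a)"
  shows "\<eta> (s * t) = \<eta> s * \<eta> t"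
proof (cases "s = 0 \<or> (\<exists>r. s = r\<^sup>2)")
  case True
  then show ?thesis
    using quadratic_character_square_mult by (cases "s = 0") auto
next
  case False
  then have s: "s \<noteq> 0" "\<eta> s = -1" by (auto simp: quadratic_character_def)
  have "\<eta> (s * u) + \<eta> u \<le> 0" for u
  proof (cases "\<exists>r. u = r\<^sup>2")
    case True
    then obtain r where r: "u = r\<^sup>2" by blast
    show ?thesis
    proof (cases "r = 0")
      case False
      then show ?thesis using quadratic_character_square_mult[OF False, of s] s r
        by (simp add: mult.commute)
    qed (use r in simp)
  next
    case False
    then show ?thesis by (auto simp: quadratic_character_def)
  qed
  moreover have "(\<Sum>u\<in>UNIV. \<eta> (s * u) + \<eta> u) = 0"
    using sum_reindex_mult[OF s(1), of \<eta>] by (simp add: sum.distrib sum_quadratic_character[OF assms])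
  ultimately have "\<eta> (s * t) + \<eta> t = 0"
    using sum_nonneg_eq_0_iff[of UNIV "\<lambda>u. - (\<eta> (s * u) + \<eta> u)"]
    by (simp add: sum_negf del: minus_add_distrib)
  with s show ?thesis by simp
qed

lemma quadratic_character_mult_self:
  fixes t :: "'a::field"
  assumes "t \<noteq> 0"
  shows "\<eta> t * \<eta> t = 1"
  using assms by (auto simp: quadratic_character_def)

text \<open>Dividing by \<open>a\<close> gives \<open>\<eta> (t / a)\<close>, and
  \<open>a * t\<close> differs from \<open>t / a\<close> by the square of \<open>a\<close>.\<close>

lemma card_scaled_square_roots:
  fixes a t :: "'a::{field,finite}"
  assumes "odd CARD('a)" and "a \<noteq> 0"
  shows "int (card {v. a * v\<^sup>2 = t}) = 1 + \<eta> (a * t)"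
proof -
  have "{v. a * v\<^sup>2 = t} = {v. v\<^sup>2 = t / a}" using assms(2) by (auto simp: field_simps)
  moreover have "\<eta> (a * t) = \<eta> (t / a)"
    using quadratic_character_square_mult[OF assms(2), of "t / a"] assms(2)
    by (simp add: power2_eq_square mult_ac)
  ultimately show ?thesis by (simp add: card_square_roots[OF assms(1)])
qed

text \<open>A quadratic Jacobi sum. For \<open>w \<noteq> 0\<close>, pulling out the square of
  \<open>u\<close> and substituting \<open>v = w / u\<close> leaves a complete character sum that
  misses only \<open>v = 0\<close>. It drives both the induction on the number of variables and the
  inversion for nontangent hyperplanes.\<close>

lemma quadratic_character_convolution:
  fixes w :: "'a::{field,finite}"
  assumes "odd CARD('a)"
  shows "(\<Sum>u\<in>UNIV. \<eta> u * \<eta> (w - u)) = \<eta> (-1::'a) * (int CARD('a) * of_bool (w = 0) - 1)"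
proof (cases "w = 0")
  case True
  have "\<eta> u * \<eta> (- u) = \<eta> (-1::'a) * of_bool (u \<noteq> 0)" for u :: 'a
    using quadratic_character_mult[OF assms, of "-1" u] quadratic_character_mult_self[of u]
    by (cases "u = 0") auto
  then have "(\<Sum>u\<in>UNIV. \<eta> u * \<eta> (w - u)) = \<eta> (-1::'a) * (\<Sum>u\<in>UNIV. of_bool (u \<noteq> (0::'a)))"
    using True by (simp add: sum_distrib_left)
  also have "(\<Sum>u\<in>UNIV. of_bool (u \<noteq> (0::'a))) = int (card (UNIV - {0::'a}))"
    by (simp add: Int_def Collect_neg_eq Compl_eq_Diff_UNIV)
  finally show ?thesis using True by (simp add: card_Diff_subset of_nat_diff)
next
  case False
  have "(\<Sum>u\<in>UNIV. \<eta> u * \<eta> (w - u)) = (\<Sum>u\<in>UNIV - {0}. \<eta> u * \<eta> (w - u))"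
    by (rule sum.mono_neutral_right) auto
  also have "\<dots> = (\<Sum>u\<in>UNIV - {0}. \<eta> (w / u - 1))"
  proof (rule sum.cong)
    fix u :: 'a
    assume "u \<in> UNIV - {0}"
    then have u: "u \<noteq> 0" by simp
    have "\<eta> u * \<eta> (w - u) = \<eta> (u * (w - u))" by (simp add: quadratic_character_mult[OF assms])
    also have "u * (w - u) = u\<^sup>2 * (w / u - 1)" using u by (simp add: field_simps power2_eq_square)
    finally show "\<eta> u * \<eta> (w - u) = \<eta> (w / u - 1)"
      by (simp add: quadratic_character_square_mult[OF u])
  qed simp
  also have "\<dots> = (\<Sum>v\<in>UNIV - {0::'a}. \<eta> (v - 1))"
    by (rule sum.reindex_bij_witness[of _ "\<lambda>v. w / v" "\<lambda>u. w / u"]) (use False in auto)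
  also have "\<dots> = (\<Sum>v\<in>(UNIV::'a set). \<eta> (v - 1)) - \<eta> (-1::'a)"
    by (subst sum_diff) auto
  also have "(\<Sum>v\<in>(UNIV::'a set). \<eta> (v - 1)) = (\<Sum>v\<in>UNIV. \<eta> (v::'a))"
    by (rule sum.reindex_bij_witness[of _ "\<lambda>v. v + 1" "\<lambda>u. u - 1"]) auto
  finally show ?thesis using False by (simp add: sum_quadratic_character[OF assms])
qed

section \<open>Zeros of diagonal forms and their hyperplane sections\<close>

text \<open>The two parities are one induction: adding a variable convolves the deviation from the
  mean \<open>q ^ (n - 1)\<close> with \<open>\<eta>\<close>. The identity is multiplied by \<open>q\<close> so that it also covers \<open>n = 0\<close>.\<close>

lemma card_diagonal_form:
  fixes a :: "'i \<Rightarrow> 'a::{field,finite}"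
  assumes odd: "odd CARD('a)" and "finite I" and "\<And>i. i \<in> I \<Longrightarrow> a i \<noteq> 0"
  shows "int CARD('a) * int (card {f \<in> I \<rightarrow>\<^sub>E UNIV. (\<Sum>i\<in>I. a i * (f i)\<^sup>2) = w}) =
    int CARD('a) ^ card I +
    (if even (card I)
     then \<eta> ((-1) ^ (card I div 2) * prod a I) * int CARD('a) ^ (card I div 2)
            * (int CARD('a) * of_bool (w = 0) - 1)
     else \<eta> ((-1) ^ (card I div 2) * prod a I * w) * int CARD('a) ^ (card I div 2 + 1))"
  using assms(2,3)
proof (induction I arbitrary: w rule: finite_induct)
  case empty
  \<comment> \<open>For the empty form the leading 1 cancels the -1 of the even case, leaving
    \<open>q * of_bool (w = 0)\<close> on both sides.\<close>
  show ?case by (cases "w = 0") auto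
next
  case (insert j I)
  define q where "q = int CARD('a)"
  define n where "n = card I"
  define c where "c = (-1) ^ (n div 2) * prod a I"
  define X where "X J w = {f \<in> J \<rightarrow>\<^sub>E (UNIV::'a set). (\<Sum>i\<in>J. a i * (f i)\<^sup>2) = w}" for J w
  define Z where "Z J w = int (card (X J w))" for J w
  have aj: "a j \<noteq> 0" using insert.prems by simp
  have fin: "finite (J \<rightarrow>\<^sub>E (UNIV::'a set))" if "finite J" for J :: "'i set"
    using that by (simp add: finite_PiE)
  have IH: "q * Z I u = q ^ n + (if even n then \<eta> c * q ^ (n div 2) * (q * of_bool (u = 0) - 1)
      else \<eta> (c * u) * q ^ (n div 2 + 1))" for u
    using insert.IH[of u] insert.prems by (simp add: q_def n_def c_def Z_def X_def)
  have sumZ: "(\<Sum>u\<in>UNIV. Z I u) = q ^ n"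
  proof -
    have "(\<Sum>u\<in>UNIV. card (X I u)) = card (I \<rightarrow>\<^sub>E (UNIV::'a set))"
      using sum.group[of "I \<rightarrow>\<^sub>E (UNIV::'a set)" UNIV "\<lambda>f. \<Sum>i\<in>I. a i * (f i)\<^sup>2" "\<lambda>_. 1::nat"]
        fin[OF insert.hyps(1)] by (simp add: X_def)
    also have "\<dots> = CARD('a) ^ n" using insert.hyps(1) by (simp add: card_PiE n_def)
    finally have "int (\<Sum>u\<in>UNIV. card (X I u)) = int (CARD('a) ^ n)" by (rule arg_cong)
    then show ?thesis by (simp add: Z_def q_def)
  qed
  \<comment> \<open>Coordinate \<open>j\<close> is split off: once the others contribute
    \<open>u\<close>, it can take \<open>1 + \<eta> (a j * (w - u))\<close> values. Resetting
    \<open>j\<close> to \<open>undefined\<close> makes the remaining function extensional on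
    \<open>I\<close>.\<close>
  have step: "Z (insert j I) w = (\<Sum>u\<in>UNIV. Z I u * (1 + \<eta> (a j * (w - u))))"
  proof -
    have "card (X (insert j I) w) = card (\<Union>u\<in>UNIV. {v. a j * v\<^sup>2 = w - u} \<times> X I u)"
    proof (rule bij_betw_same_card)
      show "bij_betw (\<lambda>f. (f j, f(j := undefined))) (X (insert j I) w)
        (\<Union>u\<in>UNIV. {v. a j * v\<^sup>2 = w - u} \<times> X I u)"
      proof (rule bij_betw_byWitness[where f' = "\<lambda>(v, f). f(j := v)"])
        show "(\<lambda>f. (f j, f(j := undefined))) ` X (insert j I) w
            \<subseteq> (\<Union>u\<in>UNIV. {v. a j * v\<^sup>2 = w - u} \<times> X I u)"
        proof (rule image_subsetI)
          fix f assume f: "f \<in> X (insert j I) w"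
          have "f(j := undefined) \<in> I \<rightarrow>\<^sub>E UNIV"
            using f insert.hyps by (auto simp: X_def PiE_def extensional_def)
          moreover have "(\<Sum>i\<in>I. a i * ((f(j := undefined)) i)\<^sup>2) = (\<Sum>i\<in>I. a i * (f i)\<^sup>2)"
            using insert.hyps by (intro sum.cong) auto
          moreover have "a j * (f j)\<^sup>2 = w - (\<Sum>i\<in>I. a i * (f i)\<^sup>2)"
            using f insert.hyps by (auto simp: X_def)
          ultimately show "(f j, f(j := undefined)) \<in> (\<Union>u\<in>UNIV. {v. a j * v\<^sup>2 = w - u} \<times> X I u)"
            unfolding X_def by blast
        qed
        show "(\<lambda>(v, f). f(j := v)) ` (\<Union>u\<in>UNIV. {v. a j * v\<^sup>2 = w - u} \<times> X I u)
            \<subseteq> X (insert j I) w"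
        proof clarify
          fix v f u
          assume v: "a j * v\<^sup>2 = w - u" and f: "f \<in> X I u"
          have "f(j := v) \<in> insert j I \<rightarrow>\<^sub>E UNIV"
            using f by (auto simp: X_def PiE_def extensional_def)
          moreover have "(\<Sum>i\<in>I. a i * ((f(j := v)) i)\<^sup>2) = (\<Sum>i\<in>I. a i * (f i)\<^sup>2)"
            using insert.hyps by (intro sum.cong) auto
          ultimately show "f(j := v) \<in> X (insert j I) w"
            using v f insert.hyps by (simp add: X_def)
        qed
        show "\<forall>f\<in>X (insert j I) w. (\<lambda>(v, f). f(j := v)) (f j, f(j := undefined)) = f"
          by simp
        have "f(j := undefined) = f" if "f \<in> X I u" for f u
          using that insert.hyps by (auto simp: X_def PiE_def extensional_def)
        then show "\<forall>p\<in>\<Union>u\<in>UNIV. {v. a j * v\<^sup>2 = w - u} \<times> X I u.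
            (\<lambda>f. (f j, f(j := undefined))) ((\<lambda>(v, f). f(j := v)) p) = p"
          by auto
      qed
    qed
    also have "\<dots> = (\<Sum>u\<in>UNIV. card ({v. a j * v\<^sup>2 = w - u} \<times> X I u))"
      using fin[OF insert.hyps(1)] by (intro card_UN_disjoint) (auto simp: X_def)
    finally show ?thesis
      by (simp add: Z_def card_cartesian_product card_scaled_square_roots[OF odd aj] mult.commute)
  qed
  have sum_shift: "(\<Sum>u\<in>UNIV. \<eta> (a j * (w - u))) = 0"
    using sum_reindex_minus[of "\<lambda>u. \<eta> (a j * u)" w] sum_reindex_mult[OF aj, of \<eta>]
    by (simp add: sum_quadratic_character[OF odd])
  have "q * Z (insert j I) w = q * (\<Sum>u\<in>UNIV. Z I u) + (\<Sum>u\<in>UNIV. q * Z I u * \<eta> (a j * (w - u)))"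
    unfolding step by (simp add: algebra_simps sum.distrib sum_distrib_left)
  \<comment> \<open>The mean can be subtracted because the shifted character sums to 0.\<close>
  also have "(\<Sum>u\<in>UNIV. q * Z I u * \<eta> (a j * (w - u))) =
      (\<Sum>u\<in>UNIV. (q * Z I u - q ^ n) * \<eta> (a j * (w - u)))"
    using sum_shift by (simp add: left_diff_distrib sum_subtractf flip: sum_distrib_left)
  finally have main: "q * Z (insert j I) w =
      q ^ Suc n + (\<Sum>u\<in>UNIV. (q * Z I u - q ^ n) * \<eta> (a j * (w - u)))"
    by (simp add: sumZ)
  have goal: "q * Z (insert j I) w = q ^ Suc n + (if even (Suc n)
     then \<eta> ((-1) ^ (Suc n div 2) * (a j * prod a I)) * q ^ (Suc n div 2) * (q * of_bool (w = 0) - 1)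
     else \<eta> ((-1) ^ (Suc n div 2) * (a j * prod a I) * w) * q ^ (Suc n div 2 + 1))"
  proof (cases "even n")
    case True
    \<comment> \<open>For even \<open>n\<close> the deviation is a point mass at 0 plus a constant;
      the character annihilates the constant, and the point mass leaves its value at
      \<open>a j * w\<close>.\<close>
    have "(\<Sum>u\<in>UNIV. (q * Z I u - q ^ n) * \<eta> (a j * (w - u))) =
       \<eta> c * q ^ (n div 2) * (\<Sum>u\<in>UNIV. q * of_bool (u = 0) * \<eta> (a j * (w - u)) - \<eta> (a j * (w - u)))"
      unfolding sum_distrib_left
      by (intro sum.cong refl) (simp add: IH True left_diff_distrib right_diff_distrib mult.assoc)
    also have "(\<Sum>u\<in>UNIV. q * of_bool (u = 0) * \<eta> (a j * (w - u)) - \<eta> (a j * (w - u)))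
        = (\<Sum>u\<in>UNIV. q * of_bool (u = 0) * \<eta> (a j * (w - u)))"
      by (simp add: sum_subtractf sum_shift)
    also have "\<dots> = (\<Sum>u\<in>UNIV. if u = 0 then q * \<eta> (a j * (w - u)) else 0)"
      by (intro sum.cong) auto
    also have "\<dots> = q * \<eta> (a j * w)" by simp
    finally have "(\<Sum>u\<in>UNIV. (q * Z I u - q ^ n) * \<eta> (a j * (w - u))) =
        \<eta> c * q ^ (n div 2) * (q * \<eta> (a j * w))" .
    moreover have "\<eta> c * \<eta> (a j * w) = \<eta> ((-1) ^ (Suc n div 2) * (a j * prod a I) * w)"
      using True by (simp add: c_def mult_ac flip: quadratic_character_mult[OF odd])
    ultimately show ?thesis using True by (simp add: main algebra_simps)
  next
    case False
    then have half: "Suc n div 2 = Suc (n div 2)" by presburger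
    \<comment> \<open>For odd \<open>n\<close> the deviation is itself a multiple of
      \<open>\<eta>\<close>, so a Jacobi sum appears; its factor \<open>\<eta> (-1)\<close> supplies
      the next power of -1.\<close>
    have "(\<Sum>u\<in>UNIV. (q * Z I u - q ^ n) * \<eta> (a j * (w - u))) =
       \<eta> c * \<eta> (a j) * q ^ (n div 2 + 1) * (\<Sum>u\<in>UNIV. \<eta> u * \<eta> (w - u))"
      unfolding sum_distrib_left
      by (intro sum.cong refl) (simp add: IH False quadratic_character_mult[OF odd])
    also have "\<dots> = \<eta> (-1 * c * a j) * q ^ Suc (n div 2) * (q * of_bool (w = 0) - 1)"
      by (simp only: quadratic_character_convolution[OF odd] q_def quadratic_character_mult[OF odd])
        simp
    also have "-1 * c * a j = (-1) ^ (Suc n div 2) * (a j * prod a I)"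
      by (simp add: half c_def mult_ac)
    finally show ?thesis using False by (simp add: main half)
  qed
  show ?case using goal insert.hyps by (simp add: q_def n_def Z_def X_def)
qed

definition diagonal_form :: "('d \<Rightarrow> 'a::field) \<Rightarrow> 'a ^ 'd \<Rightarrow> 'a" where
  "diagonal_form a x = (\<Sum>i\<in>UNIV. a i * (x $ i)\<^sup>2)"

text \<open>The induction needs functions on varying index sets, the geometry needs vectors; over
  the full index type the two agree.\<close>

lemma card_diagonal_form_vec:
  fixes a :: "'d::finite \<Rightarrow> 'a::{field,finite}"
  shows "card {x. diagonal_form a x = w} = card {f \<in> UNIV \<rightarrow>\<^sub>E UNIV. (\<Sum>i\<in>UNIV. a i * (f i)\<^sup>2) = w}"
  by (rule bij_betw_same_card[where f = vec_nth], rule bij_betw_byWitness[where f' = vec_lambda])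
    (auto simp: diagonal_form_def)

section \<open>Tangent and nontangent hyperplane sections\<close>

text \<open>Translations along an axis on which \<open>m\<close> is nonzero permute the level sets,
  so all of them have the same size.\<close>

lemma card_hyperplane:
  fixes m :: "'a::{field,finite} ^ 'd::finite"
  assumes "m \<noteq> 0"
  shows "CARD('a) * card {x. scalar_product m x = v} = CARD('a) ^ CARD('d)"
proof -
  obtain j where j: "m $ j \<noteq> 0" using assms by (metis vec_eq_iff zero_index)
  have shift: "scalar_product m (x + axis j t) = scalar_product m x + m $ j * t" for x t
  proof -
    have "scalar_product m (axis j t) = (\<Sum>i\<in>UNIV. if i = j then m $ j * t else 0)"
      unfolding scalar_product_def by (intro sum.cong) (auto simp: axis_def)
    then show ?thesis by (simp add: scalar_product_def algebra_simps sum.distrib)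
  qed
  have cancel: "x + axis j t + axis j (- t) = x" "x + axis j (- t) + axis j t = x"
    for x :: "'a ^ 'd" and t
    by (simp_all add: vec_eq_iff axis_def)
  have level: "card {x. scalar_product m x = u} = card {x. scalar_product m x = v}" for u
    by (rule bij_betw_same_card[where f = "\<lambda>x. x + axis j ((v - u) / m $ j)"],
        rule bij_betw_byWitness[where f' = "\<lambda>x. x + axis j (- ((v - u) / m $ j))"])
      (use j in \<open>auto simp: shift cancel\<close>)
  have "CARD('a ^ 'd) = (\<Sum>u\<in>(UNIV::'a set). card {x. scalar_product m x = u})"
    using sum.group[of "UNIV::('a ^ 'd) set" "UNIV::'a set" "scalar_product m" "\<lambda>_. 1::nat"] by simp
  also have "\<dots> = (\<Sum>u\<in>(UNIV::'a set). card {x. scalar_product m x = v})"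
    by (intro sum.cong refl level)
  finally show ?thesis by simp
qed

text \<open>Translation by \<open>r * m / (2 * a)\<close> completes the square.\<close>

lemma card_section_translate:
  fixes a :: "'d::finite \<Rightarrow> 'a::{field,finite}"
  assumes odd: "odd CARD('a)" and a: "\<And>i. a i \<noteq> 0"
    and D: "D = (\<Sum>i\<in>UNIV. (m $ i)\<^sup>2 / (4 * a i))"
  shows "card {x. diagonal_form a x = u \<and> scalar_product m x = v} =
    card {x. diagonal_form a x = u + r * v + r\<^sup>2 * D \<and> scalar_product m x = v + 2 * r * D}"
proof -
  \<comment> \<open>\<open>y\<close> represents the functional \<open>scalar_product m\<close> under
    the polar form of \<open>diagonal_form a\<close>, and \<open>D\<close> is the value of the form
    at \<open>y\<close>.\<close>
  define y :: "'a ^ 'd" where "y = (\<chi> i. m $ i / (2 * a i))"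
  have two: "(2::'a) \<noteq> 0" by (rule two_neq_zero[OF odd])
  then have four: "(4::'a) \<noteq> 0" by (metis mult_2 mult_eq_0_iff numeral_Bit0)
  have Q: "diagonal_form a (x + s *s y) = diagonal_form a x + s * scalar_product m x + s\<^sup>2 * D" for x s
  proof -
    have "a i * (x $ i + s * (m $ i / (2 * a i)))\<^sup>2 =
        a i * (x $ i)\<^sup>2 + s * (m $ i * x $ i) + s\<^sup>2 * ((m $ i)\<^sup>2 / (4 * a i))" for i
    proof -
      \<comment> \<open>In terms of \<open>t\<close> the denominators disappear and a polynomial
        identity remains.\<close>
      define t where "t = m $ i / (2 * a i)"
      have mi: "m $ i = 2 * a i * t" using a two by (simp add: t_def)
      have "(m $ i)\<^sup>2 / (4 * a i) = a i * t\<^sup>2"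
        using a four by (simp add: mi power2_eq_square)
      then show ?thesis
        unfolding t_def[symmetric] by (simp add: mi power2_eq_square algebra_simps)
    qed
    then show ?thesis
      by (simp add: diagonal_form_def y_def D scalar_product_def sum.distrib sum_distrib_left)
  qed
  have L: "scalar_product m (x + s *s y) = scalar_product m x + 2 * s * D" for x s
  proof -
    have "m $ i * (x $ i + s * (m $ i / (2 * a i))) =
        m $ i * x $ i + 2 * s * ((m $ i)\<^sup>2 / (4 * a i))" for i
    proof -
      define t where "t = m $ i / (2 * a i)"
      have mi: "m $ i = 2 * a i * t" using a two by (simp add: t_def)
      have "(m $ i)\<^sup>2 / (4 * a i) = a i * t\<^sup>2"
        using a four by (simp add: mi power2_eq_square)
      then show ?thesis
        unfolding t_def[symmetric] by (simp add: mi power2_eq_square algebra_simps)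
    qed
    then show ?thesis
      by (simp add: y_def D scalar_product_def sum.distrib sum_distrib_left)
  qed
  show ?thesis
  proof (rule bij_betw_same_card[where f = "\<lambda>x. x + r *s y"],
      rule bij_betw_byWitness[where f' = "\<lambda>x. x + (- r) *s y"])
    show "\<forall>x\<in>{x. diagonal_form a x = u \<and> scalar_product m x = v}. x + r *s y + (- r) *s y = x"
      by (simp add: vec_eq_iff)
    show "\<forall>x\<in>{x. diagonal_form a x = u + r * v + r\<^sup>2 * D \<and> scalar_product m x = v + 2 * r * D}.
        x + (- r) *s y + r *s y = x"
      by (simp add: vec_eq_iff)
    show "(\<lambda>x. x + r *s y) ` {x. diagonal_form a x = u \<and> scalar_product m x = v}
        \<subseteq> {x. diagonal_form a x = u + r * v + r\<^sup>2 * D \<and> scalar_product m x = v + 2 * r * D}"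
      by (auto simp: Q L)
    show "(\<lambda>x. x + (- r) *s y) `
        {x. diagonal_form a x = u + r * v + r\<^sup>2 * D \<and> scalar_product m x = v + 2 * r * D}
        \<subseteq> {x. diagonal_form a x = u \<and> scalar_product m x = v}"
      unfolding image_subset_iff mem_Collect_eq Q L
      by (auto simp: power2_eq_square algebra_simps)
  qed
qed

text \<open>With \<open>D = 0\<close>, translation preserves the level \<open>v\<close> and shifts
  the value of the form by \<open>r * v\<close>. Hence the form is equidistributed on each level
  \<open>v \<noteq> 0\<close>, and the zeros on level 0 follow by subtraction.\<close>

lemma card_tangent_section:
  fixes a :: "'d::finite \<Rightarrow> 'a::{field,finite}"
  assumes odd: "odd CARD('a)" and a: "\<And>i. a i \<noteq> 0" and m: "m \<noteq> 0"
    and D: "(\<Sum>i\<in>UNIV. (m $ i)\<^sup>2 / (4 * a i)) = 0"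
  shows "int CARD('a) * int (card {x. diagonal_form a x = 0 \<and> scalar_product m x = 0})
      - int (card {x. diagonal_form a x = 0}) =
    (int CARD('a) - 1) * (int (card {x. diagonal_form a x = 0}) - int CARD('a) ^ (CARD('d) - 1))"
proof -
  define q where "q = int CARD('a)"
  define A where "A u v = card {x. diagonal_form a x = u \<and> scalar_product m x = v}" for u v
  have q0: "q \<noteq> 0" by (simp add: q_def)
  have H: "int (card {x. scalar_product m x = v}) = q ^ (CARD('d) - 1)" for v
  proof -
    have "q * int (card {x. scalar_product m x = v}) = q ^ CARD('d)"
      unfolding q_def by (metis card_hyperplane[OF m] of_nat_mult of_nat_power)
    also have "\<dots> = q * q ^ (CARD('d) - 1)" by (metis power_eq_if zero_less_card_finite less_irrefl)
    finally show ?thesis using q0 by simp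
  qed
  have A: "q * int (A 0 v) = q ^ (CARD('d) - 1)" if "v \<noteq> 0" for v
  proof -
    \<comment> \<open>The choice \<open>r = - u / v\<close> carries the value \<open>u\<close> to
      0.\<close>
    have eq: "A u v = A 0 v" for u
      using card_section_translate[OF odd a refl, where u = u and v = v and m = m and r = "- u / v"] that D
      by (simp add: A_def)
    have "card {x. scalar_product m x = v} = (\<Sum>u\<in>UNIV. A u v)"
      using sum.group[of "{x. scalar_product m x = v}" UNIV "diagonal_form a" "\<lambda>_. 1::nat"]
      by (simp add: A_def conj_commute)
    also have "\<dots> = (\<Sum>u\<in>(UNIV::'a set). A 0 v)" by (intro sum.cong refl eq)
    finally show ?thesis using H[of v] by (simp add: q_def)
  qed
  have "card {x. diagonal_form a x = 0} = (\<Sum>v\<in>UNIV. A 0 v)"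
    using sum.group[of "{x. diagonal_form a x = 0}" UNIV "scalar_product m" "\<lambda>_. 1::nat"]
    by (simp add: A_def)
  also have "\<dots> = A 0 0 + (\<Sum>v\<in>UNIV - {0}. A 0 v)"
    by (simp add: sum.remove)
  finally have "q * int (card {x. diagonal_form a x = 0})
      = q * int (A 0 0) + (\<Sum>v\<in>UNIV - {0}. q * int (A 0 v))"
    by (simp add: sum_distrib_left distrib_left)
  also have "(\<Sum>v\<in>UNIV - {0}. q * int (A 0 v)) = (\<Sum>v\<in>UNIV - {0::'a}. q ^ (CARD('d) - 1))"
    by (intro sum.cong) (auto simp: A)
  also have "\<dots> = (q - 1) * q ^ (CARD('d) - 1)"
    by (simp add: card_Diff_subset q_def)
  finally show ?thesis unfolding q_def[symmetric] A_def by (simp add: algebra_simps)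
qed

text \<open>The form is the orthogonal sum of its restriction to the hyperplane and a unary form, so its
  value distribution is a convolution with \<open>\<eta>\<close>, which is inverted by convolving once more.\<close>

lemma card_nontangent_section:
  fixes a :: "'d::finite \<Rightarrow> 'a::{field,finite}"
  assumes odd: "odd CARD('a)" and a: "\<And>i. a i \<noteq> 0" and m: "m \<noteq> 0"
    and D: "D = (\<Sum>i\<in>UNIV. (m $ i)\<^sup>2 / (4 * a i))" and D0: "D \<noteq> 0"
  shows "(\<Sum>w\<in>UNIV. int (card {x. diagonal_form a x = w}) * \<eta> (- D * w)) =
    \<eta> (-1::'a) * (int CARD('a) * int (card {x. diagonal_form a x = 0 \<and> scalar_product m x = 0})
      - int CARD('a) ^ (CARD('d) - 1))"
proof -
  define q where "q = int CARD('a)"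
  define A where "A u v = card {x. diagonal_form a x = u \<and> scalar_product m x = v}" for u v
  define Z where "Z w = int (card {x. diagonal_form a x = w})" for w
  have two: "(2::'a) \<noteq> 0" by (rule two_neq_zero[OF odd])
  then have four: "(4::'a) \<noteq> 0" by (metis mult_2 mult_eq_0_iff numeral_Bit0)
  \<comment> \<open>Translating level \<open>v\<close> to level 0 takes
    \<open>r = - v / (2 * D)\<close> and lowers the form by \<open>c * v\<^sup>2\<close>. Since
    \<open>D\<close> is \<open>c\<close> times the square of \<open>2 * D\<close>, both have the
    same character.\<close>
  define c where "c = 1 / (4 * D)"
  have c0: "c \<noteq> 0" using D0 four by (simp add: c_def)
  have etac: "\<eta> (c * t) = \<eta> (D * t)" for t
  proof -
    have "D * t = (2 * D)\<^sup>2 * (c * t)" using D0 four by (simp add: c_def power2_eq_square)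
    then show ?thesis using quadratic_character_square_mult[of "2 * D" "c * t"] two D0
      by (metis mult_eq_0_iff)
  qed
  have q0: "q \<noteq> 0" by (simp add: q_def)
  have sumA: "(\<Sum>u\<in>UNIV. int (A u 0)) = q ^ (CARD('d) - 1)"
  proof -
    have "q * int (card {x. scalar_product m x = 0}) = q ^ CARD('d)"
      unfolding q_def by (metis card_hyperplane[OF m] of_nat_mult of_nat_power)
    also have "\<dots> = q * q ^ (CARD('d) - 1)" by (metis power_eq_if zero_less_card_finite less_irrefl)
    finally have "int (card {x. scalar_product m x = 0}) = q ^ (CARD('d) - 1)" using q0 by simp
    moreover have "card {x. scalar_product m x = 0} = (\<Sum>u\<in>UNIV. A u 0)"
      using sum.group[of "{x. scalar_product m x = 0}" UNIV "diagonal_form a" "\<lambda>_. 1::nat"]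
      by (simp add: A_def conj_commute)
    ultimately show ?thesis by simp
  qed
  have A: "A w v = A (w - c * v\<^sup>2) 0" for w v
  proof -
    define r where "r = - v / (2 * D)"
    have v: "v = - (2 * r * D)" using two D0 by (simp add: r_def)
    have "c * v\<^sup>2 = r\<^sup>2 * D" using four D0 by (simp add: c_def v power2_eq_square)
    then have "w + r * v + r\<^sup>2 * D = w - c * v\<^sup>2"
      by (simp add: v power2_eq_square algebra_simps)
    moreover have "v + 2 * r * D = 0" by (simp add: v)
    ultimately show ?thesis
      using card_section_translate[OF odd a D, where u = w and v = v and r = r] by (simp only: A_def)
  qed
  \<comment> \<open>Summing over all levels \<open>v\<close> counts each \<open>u\<close> once for
    every solution of \<open>c * v\<^sup>2 = w - u\<close>.\<close>
  have Z: "Z w = (\<Sum>u\<in>UNIV. int (A u 0) * (1 + \<eta> (D * (w - u))))" for w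
  proof -
    have "card {x. diagonal_form a x = w} = (\<Sum>v\<in>UNIV. A w v)"
      using sum.group[of "{x. diagonal_form a x = w}" UNIV "scalar_product m" "\<lambda>_. 1::nat"]
      by (simp add: A_def)
    also have "\<dots> = (\<Sum>v\<in>UNIV. A (w - c * v\<^sup>2) 0)" by (intro sum.cong refl A)
    also have "\<dots> = (\<Sum>u\<in>UNIV. \<Sum>v\<in>{v. w - c * v\<^sup>2 = u}. A (w - c * v\<^sup>2) 0)"
      using sum.group[of "UNIV::'a set" "UNIV::'a set" "\<lambda>v. w - c * v\<^sup>2" "\<lambda>v. A (w - c * v\<^sup>2) 0"]
      by simp
    also have "\<dots> = (\<Sum>u\<in>UNIV. card {v. c * v\<^sup>2 = w - u} * A u 0)"
    proof (intro sum.cong refl)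
      fix u
      have "(\<Sum>v\<in>{v. w - c * v\<^sup>2 = u}. A (w - c * v\<^sup>2) 0) = (\<Sum>v\<in>{v. w - c * v\<^sup>2 = u}. A u 0)"
        by (intro sum.cong) auto
      moreover have "{v. w - c * v\<^sup>2 = u} = {v. c * v\<^sup>2 = w - u}" by (auto simp: algebra_simps)
      ultimately show "(\<Sum>v\<in>{v. w - c * v\<^sup>2 = u}. A (w - c * v\<^sup>2) 0)
          = card {v. c * v\<^sup>2 = w - u} * A u 0" by simp
    qed
    finally show ?thesis
      by (simp add: Z_def card_scaled_square_roots[OF odd c0] etac mult.commute)
  qed
  have sum0: "(\<Sum>w\<in>UNIV. \<eta> (- D * w)) = 0"
    using sum_reindex_mult[of "- D" \<eta>] D0 sum_quadratic_character[OF odd] by simp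
  \<comment> \<open>The minus sign in the weight turns \<open>w - u\<close> into
    \<open>u - w\<close>, so the sum over \<open>w\<close> is the convolution of
    \<open>\<eta>\<close> with itself at \<open>u\<close>. Its point mass isolates
    \<open>A 0 0\<close>.\<close>
  have J: "(\<Sum>w\<in>UNIV. \<eta> (D * (w - u)) * \<eta> (- D * w)) = \<eta> (-1::'a) * (q * of_bool (u = 0) - 1)"
    for u
  proof -
    have "\<eta> (D * (w - u)) * \<eta> (- D * w) = \<eta> w * \<eta> (u - w)" for w
    proof -
      have "D * (w - u) * (- D * w) = D\<^sup>2 * (w * (u - w))"
        by (simp add: power2_eq_square algebra_simps)
      then have "\<eta> (D * (w - u) * (- D * w)) = \<eta> (w * (u - w))"
        using quadratic_character_square_mult[OF D0] by simp
      then show ?thesis by (simp only: quadratic_character_mult[OF odd])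
    qed
    then show ?thesis by (simp only: quadratic_character_convolution[OF odd] q_def)
  qed
  have "(\<Sum>w\<in>UNIV. Z w * \<eta> (- D * w)) =
      (\<Sum>w\<in>UNIV. \<Sum>u\<in>UNIV. int (A u 0) * (\<eta> (- D * w) + \<eta> (D * (w - u)) * \<eta> (- D * w)))"
    unfolding Z sum_distrib_right by (intro sum.cong refl) (simp only: algebra_simps mult_1_left mult_1_right)
  also have "\<dots> = (\<Sum>u\<in>UNIV. int (A u 0) *
      (\<Sum>w\<in>UNIV. \<eta> (- D * w) + \<eta> (D * (w - u)) * \<eta> (- D * w)))"
    by (subst sum.swap) (simp only: sum_distrib_left)
  also have "\<dots> = (\<Sum>u\<in>UNIV. int (A u 0) * (\<eta> (-1::'a) * (q * of_bool (u = 0) - 1)))"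
    by (simp only: sum.distrib sum0 J add_0)
  also have "\<dots> = \<eta> (-1::'a) * (\<Sum>u\<in>UNIV. (if u = 0 then q * int (A u 0) else 0) - int (A u 0))"
    unfolding sum_distrib_left by (intro sum.cong refl) (simp add: algebra_simps)
  also have "\<dots> = \<eta> (-1::'a) * (q * int (A 0 0) - q ^ (CARD('d) - 1))"
    by (simp add: sum_subtractf sumA)
  finally show ?thesis by (simp add: Z_def q_def A_def)
qed

section \<open>A uniform bound for hyperplane sections of the cone\<close>

lemma abs_quadratic_character_le: "\<bar>\<eta> t\<bar> \<le> 1"
  by (simp add: quadratic_character_def)

text \<open>The left side is what one pair of points contributes to the later double count. The
  value of \<open>R\<close> is dictated by nontangent sections when \<open>n\<close> is odd or
  \<open>\<epsilon> = -1\<close>, and by tangent sections when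
  \<open>\<epsilon> = 1\<close>.\<close>

lemma card_isotropic_section_le:
  fixes a :: "'d::finite \<Rightarrow> 'a::{field,finite}" and m :: "'a ^ 'd"
  defines "q \<equiv> int CARD('a)" and "n \<equiv> CARD('d)"
  defines "\<epsilon> \<equiv> \<eta> ((-1) ^ (n div 2) * prod a UNIV)"
  assumes odd: "odd CARD('a)" and a: "\<And>i. a i \<noteq> 0"
    and R: "odd n \<and> R = q ^ ((n - 1) div 2) \<or> even n \<and> \<epsilon> = -1 \<and> R = q ^ ((n - 2) div 2) \<or>
      even n \<and> \<epsilon> = 1 \<and> R = q ^ (n div 2) - q ^ ((n - 2) div 2)"
  shows "q * int (card {x. diagonal_form a x = 0 \<and> scalar_product m x = 0})
      - int (card {x. diagonal_form a x = 0})
    \<le> (q - 1) * (q ^ (n - 1) * of_bool (m = 0) + R)"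
proof -
  define Z where "Z w = int (card {x. diagonal_form a x = w})" for w
  define M where "M = int (card {x. diagonal_form a x = 0 \<and> scalar_product m x = 0})"
  have q1: "q \<ge> 1" by (simp add: q_def Suc_leI)
  have n0: "n > 0" by (simp add: n_def)
  then have qn: "q ^ n = q * q ^ (n - 1)" by (simp add: power_eq_if)
  define h where "h = n div 2"
  have qZ: "q * Z w = q ^ n + (if even n then \<epsilon> * q ^ h * (q * of_bool (w = 0) - 1)
      else \<eta> ((-1) ^ h * prod a UNIV * w) * q ^ (h + 1))" for w
    using card_diagonal_form[OF odd finite_class.finite_UNIV, of a w] a
    by (simp only: not_False_eq_True simp_thms Z_def card_diagonal_form_vec q_def n_def \<epsilon>_def h_def)
  \<comment> \<open>The first inequality serves \<open>m = 0\<close> and tangent hyperplanes, the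
    second nontangent ones in even dimension.\<close>
  have z_le: "Z 0 - q ^ (n - 1) \<le> R"
    and neg_z_le: "even n \<Longrightarrow> q ^ (n - 1) - Z 0 \<le> (q - 1) * R"
  proof -
    have "Z 0 - q ^ (n - 1) \<le> R \<and> (even n \<longrightarrow> q ^ (n - 1) - Z 0 \<le> (q - 1) * R)"
    proof (cases "even n")
      case True
      \<comment> \<open>Positive even \<open>n\<close> has \<open>h = j + 1\<close>, so a factor
        \<open>q\<close> can be cancelled from \<open>q ^ h\<close>.\<close>
      then obtain j where j: "h = Suc j" "(n - 2) div 2 = j" "n div 2 = Suc j"
        using n0 by (auto simp: h_def elim!: evenE intro: that[of "n div 2 - 1"])
      have "q * Z 0 = q * (q ^ (n - 1) + \<epsilon> * q ^ j * (q - 1))"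
        using qZ[of 0] True by (simp add: qn j algebra_simps)
      then have z: "Z 0 - q ^ (n - 1) = \<epsilon> * (q ^ j * (q - 1))" using q1 by simp
      have pos: "q ^ j * (q - 1) \<ge> 0" using q1 by simp
      from R True consider "\<epsilon> = -1" "R = q ^ j" | "\<epsilon> = 1" "R = q ^ j * (q - 1)"
        by (auto simp: j algebra_simps)
      then show ?thesis
      proof cases
        case 1
        have "R \<ge> 0" using 1 q1 by simp
        moreover have "Z 0 - q ^ (n - 1) = - (q ^ j * (q - 1))" using z 1 by simp
        moreover have "q ^ j * (q - 1) = (q - 1) * R" using 1 by simp
        ultimately show ?thesis using pos by linarith
      next
        case 2
        have "Z 0 - q ^ (n - 1) = R" using z 2 by simp
        moreover have "R \<ge> 0" using pos 2 by simp
        moreover have "(q - 1) * R \<ge> 0" using pos 2 q1 by simp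
        ultimately show ?thesis by linarith
      qed
    next
      case False
      have "q * Z 0 = q * q ^ (n - 1)" using qZ[of 0] False by (simp add: qn)
      then have "Z 0 = q ^ (n - 1)" using q1 by simp
      then show ?thesis using R False q1 by simp
    qed
    then show "Z 0 - q ^ (n - 1) \<le> R" "even n \<Longrightarrow> q ^ (n - 1) - Z 0 \<le> (q - 1) * R"
      by auto
  qed
  have mono: "(q - 1) * (Z 0 - q ^ (n - 1)) \<le> (q - 1) * R"
    using z_le q1 by (intro mult_left_mono) auto
  have "q * M - Z 0 \<le> (q - 1) * (q ^ (n - 1) * of_bool (m = 0) + R)"
  proof (cases "m = 0")
    case True
    then have "M = Z 0" by (simp add: M_def Z_def scalar_product_def)
    then show ?thesis using mono True by (simp add: algebra_simps)
  next
    case m: False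
    define D where "D = (\<Sum>i\<in>UNIV. (m $ i)\<^sup>2 / (4 * a i))"
    show ?thesis
    proof (cases "D = 0")
      case True
      have "q * M - Z 0 = (q - 1) * (Z 0 - q ^ (n - 1))"
        using card_tangent_section[OF odd a m True[unfolded D_def]]
        by (simp only: q_def M_def Z_def n_def)
      then show ?thesis using mono m by simp
    next
      case D: False
      define S where "S = (\<Sum>w\<in>UNIV. Z w * \<eta> (- D * w))"
      have S: "S = \<eta> (-1::'a) * (q * M - q ^ (n - 1))"
        using card_nontangent_section[OF odd a m D_def D]
        by (simp only: S_def q_def M_def Z_def n_def)
      have M: "q * M - q ^ (n - 1) = \<eta> (-1::'a) * S"
        using quadratic_character_mult_self[of "-1::'a"] by (simp add: S flip: mult.assoc)
      have sum0: "(\<Sum>w\<in>UNIV. \<eta> (- D * w)) = 0"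
        using sum_reindex_mult[of "- D" \<eta>] D sum_quadratic_character[OF odd] by simp
      have "q * S = (\<Sum>w\<in>UNIV. (q * Z w - q ^ n) * \<eta> (- D * w)) + q ^ n * (\<Sum>w\<in>UNIV. \<eta> (- D * w))"
        unfolding S_def sum_distrib_left sum.distrib[symmetric]
        by (intro sum.cong refl) (simp only: algebra_simps)
      then have qS: "q * S = (\<Sum>w\<in>UNIV. (q * Z w - q ^ n) * \<eta> (- D * w))" by (simp only: sum0)
      show ?thesis
      proof (cases "even n")
        case True
        \<comment> \<open>The deviation is constant except at \<open>w = 0\<close>, where the
          character vanishes; hence \<open>S = 0\<close> and \<open>q * M\<close> equals the mean
          \<open>q ^ (n - 1)\<close>.\<close>
        have "q * S = (\<Sum>w\<in>UNIV. - (\<epsilon> * q ^ h) * \<eta> (- D * w))"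
          unfolding qS by (intro sum.cong refl) (auto simp: qZ True)
        also have "\<dots> = 0" by (simp only: sum0 flip: sum_distrib_left)
        finally have "S = 0" using q1 by simp
        then show ?thesis using M neg_z_le[OF True] m by simp
      next
        case False
        \<comment> \<open>For odd \<open>n\<close> the deviation is proportional to
          \<open>\<eta> w\<close>; against the weight it becomes a constant on nonzero
          \<open>w\<close>, with sign \<open>e\<close>.\<close>
        define e where "e = \<eta> ((-1) ^ h * prod a UNIV) * \<eta> (- D)"
        have "q * S = (\<Sum>w\<in>UNIV. q ^ (h + 1) * e * of_bool (w \<noteq> (0::'a)))"
          unfolding qS
        proof (intro sum.cong refl)
          fix w :: 'a
          have "\<eta> w * \<eta> w = of_bool (w \<noteq> 0)" using quadratic_character_mult_self[of w] by auto
          moreover have "(q * Z w - q ^ n) * \<eta> (- D * w) = q ^ (h + 1) * e * (\<eta> w * \<eta> w)"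
            using False by (simp only: qZ quadratic_character_mult[OF odd] e_def if_False) simp
          ultimately show "(q * Z w - q ^ n) * \<eta> (- D * w) = q ^ (h + 1) * e * of_bool (w \<noteq> 0)"
            by simp
        qed
        also have "\<dots> = q ^ (h + 1) * e * (\<Sum>w\<in>UNIV. of_bool (w \<noteq> (0::'a)))"
          by (simp only: sum_distrib_left)
        also have "(\<Sum>w\<in>UNIV. of_bool (w \<noteq> (0::'a))) = int (card (UNIV - {0::'a}))"
          by (simp add: Int_def Collect_neg_eq Compl_eq_Diff_UNIV)
        also have "\<dots> = q - 1" by (simp add: card_Diff_subset q_def)
        finally have "q * S = q * (q ^ h * e * (q - 1))" by (simp add: mult.assoc)
        then have S': "S = q ^ h * e * (q - 1)" using q1 by simp
        have z: "Z 0 = q ^ (n - 1)"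
        proof -
          have "q * Z 0 = q * q ^ (n - 1)" using qZ[of 0] False by (simp add: qn)
          then show ?thesis using q1 by simp
        qed
        have "\<bar>\<eta> (-1::'a) * e\<bar> \<le> 1"
          unfolding e_def abs_mult
          by (intro mult_le_one abs_quadratic_character_le mult_nonneg_nonneg abs_ge_zero)
        then have "\<eta> (-1::'a) * e \<le> 1" by linarith
        then have "\<eta> (-1::'a) * e * (q ^ h * (q - 1)) \<le> 1 * (q ^ h * (q - 1))"
          using q1 by (intro mult_right_mono) auto
        moreover have "R = q ^ h"
        proof -
          have "(n - 1) div 2 = h" using False by (auto simp: h_def elim: oddE)
          then show ?thesis using R False by simp
        qed
        ultimately show ?thesis using M S' z m by (simp add: mult_ac)
      qed
    qed
  qed
  then show ?thesis by (simp only: M_def Z_def)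
qed

section \<open>Lines with few cosets\<close>

text \<open>Cauchy-Schwarz for the fibre sizes of \<open>f\<close>: they add up to
  \<open>card E\<close>, and their squares count the colliding pairs.\<close>

lemma card_squared_le_card_image_mult:
  assumes "finite E"
  shows "(card E)\<^sup>2 \<le> card (f ` E) * card {p \<in> E \<times> E. f (fst p) = f (snd p)}"
proof -
  define F where "F c = {y \<in> E. f y = c}" for c
  have fin: "finite (F c)" for c using assms by (simp add: F_def)
  have E: "card E = (\<Sum>c\<in>f ` E. card (F c))"
    using sum.group[of E "f ` E" f "\<lambda>_. 1::nat"] assms by (simp add: F_def)
  have U: "{p \<in> E \<times> E. f (fst p) = f (snd p)} = (\<Union>c\<in>f ` E. F c \<times> F c)"
    by (auto simp: F_def)
  have pairs: "card {p \<in> E \<times> E. f (fst p) = f (snd p)} = (\<Sum>c\<in>f ` E. (card (F c))\<^sup>2)"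
  proof -
    have "card (\<Union>c\<in>f ` E. F c \<times> F c) = (\<Sum>c\<in>f ` E. card (F c \<times> F c))"
      using assms fin by (intro card_UN_disjoint) (auto simp: F_def)
    with U show ?thesis by (simp add: card_cartesian_product power2_eq_square)
  qed
  have "(\<Sum>c\<in>f ` E. real (card (F c)))\<^sup>2 \<le> (\<Sum>c\<in>f ` E. (real (card (F c)))\<^sup>2) * card (f ` E)"
    using sum_squared_le_sum_of_squares[of "\<lambda>c. real (card (F c))" "f ` E"] assms
    by (simp add: field_simps)
  then have "real ((card E)\<^sup>2) \<le> real (card (f ` E) * card {p \<in> E \<times> E. f (fst p) = f (snd p)})"
    by (simp add: E pairs mult.commute)
  then show ?thesis by (simp only: of_nat_le_iff)
qed

lemma one_dimensional_eq_range:
  fixes x :: "'a::field ^ 'd::finite"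
  assumes "vec.subspace V" and "vec.dim V = 1" and "x \<in> V" and "x \<noteq> 0"
  shows "V = range (\<lambda>c. c *s x)"
proof -
  have "vec.span {x} \<subseteq> V" using assms by (simp add: vec.span_minimal)
  then have "vec.span {x} = V"
    using assms vec.subspace_dim_equal[of "vec.span {x}" V] by (simp add: vec.dim_span)
  then show ?thesis by (simp add: vec.span_singleton)
qed

lemma scalar_product_scale_right: "scalar_product y (c *s x) = c * scalar_product y x"
  for x :: "'a::field ^ 'd::finite"
  by (simp add: scalar_product_def sum_distrib_left mult_ac)

lemma scalar_product_diff_left: "scalar_product (y - z) x = scalar_product y x - scalar_product z x"
  for x :: "'a::field ^ 'd::finite"
  by (simp add: scalar_product_def sum_subtractf left_diff_distrib)

text \<open>When \<open>x\<close> spans \<open>V\<close>, the cosets of \<open>perp V\<close> are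
  level sets of the product with \<open>x\<close>, so counting cosets becomes counting values on
  \<open>E\<close>.\<close>

lemma card_coset_projection:
  fixes x :: "'a::field ^ 'd::finite"
  assumes V: "V = range (\<lambda>c. c *s x)"
  shows "card (coset_projection V E) = card ((\<lambda>y. scalar_product y x) ` E)"
proof -
  have perp: "y \<in> perp V \<longleftrightarrow> scalar_product y x = 0" for y
  proof -
    have "x \<in> V" unfolding V by (rule range_eqI[of _ _ 1]) simp
    then show ?thesis by (auto simp: perp_def V scalar_product_scale_right)
  qed
  have coset: "(+) y ` perp V = {z. scalar_product z x = scalar_product y x}" for y
  proof (intro equalityI subsetI)
    fix z assume "z \<in> {z. scalar_product z x = scalar_product y x}"
    then have "z - y \<in> perp V" by (simp add: perp scalar_product_diff_left)
    then show "z \<in> (+) y ` perp V" by (intro image_eqI[of _ _ "z - y"]) auto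
  next
    fix z assume "z \<in> (+) y ` perp V"
    then have "z - y \<in> perp V" by auto
    then show "z \<in> {z. scalar_product z x = scalar_product y x}"
      by (simp add: perp scalar_product_diff_left)
  qed
  have "coset_projection V E = (\<lambda>y. {z. scalar_product z x = scalar_product y x}) ` E"
  proof (intro equalityI subsetI)
    fix A assume "A \<in> coset_projection V E"
    then obtain y where A: "A = {z. scalar_product z x = scalar_product y x}" and "A \<inter> E \<noteq> {}"
      by (auto simp: coset_projection_def coset)
    then obtain z where "z \<in> E" "scalar_product z x = scalar_product y x" by blast
    with A show "A \<in> (\<lambda>y. {z. scalar_product z x = scalar_product y x}) ` E"
      by (intro image_eqI[of _ _ z]) auto
  qed (auto simp: coset_projection_def coset)
  also have "\<dots> = (\<lambda>c. {z. scalar_product z x = c}) ` (\<lambda>y. scalar_product y x) ` E"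
    by (simp add: image_image)
  also have "card \<dots> = card ((\<lambda>y. scalar_product y x) ` E)"
    by (rule card_image) (force simp: inj_on_def)
  finally show ?thesis .
qed

text \<open>The double count is separated from the arithmetic: of the quadratic form only the bound
  on hyperplane sections of \<open>C\<close> remains.\<close>

lemma card_lines_in_cone_bound:
  fixes C E :: "('a::{field,finite} ^ 'd::finite) set" and T :: "('a ^ 'd) set set" and N R :: real
  defines "q \<equiv> real CARD('a)"
  assumes E: "E \<noteq> {}" and N: "0 < N" "N < q"
    and line: "\<And>V. V \<in> T \<Longrightarrow> vec.subspace V \<and> vec.dim V = 1 \<and> V \<subseteq> C"
    and proj: "\<And>V. V \<in> T \<Longrightarrow> real (card (coset_projection V E)) \<le> N"
    and sections: "\<And>m. q * real (card {x \<in> C. scalar_product m x = 0}) - real (card C)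
      \<le> (q - 1) * (q ^ (CARD('d) - 1) * of_bool (m = 0) + R)"
  shows "real (card T) \<le> N * q ^ (CARD('d) - 1) / ((q - N) * real (card E)) + N * R / (q - N)"
proof -
  define e where "e = real (card E)"
  have e: "e > 0" using E by (simp add: e_def card_gt_0_iff)
  have q1: "q > 1"
    using card_mono[of "UNIV::'a set" "{0, 1}"] by (simp add: q_def)
  define f where "f x = real (card {p \<in> E \<times> E. scalar_product (fst p) x = scalar_product (snd p) x})" for x
  define g where "g x = f x - e\<^sup>2 / q" for x
  have cs: "e\<^sup>2 \<le> K * f x" if "real (card ((\<lambda>y. scalar_product y x) ` E)) \<le> K" for K x
  proof -
    have "real ((card E)\<^sup>2) \<le> real (card ((\<lambda>y. scalar_product y x) ` E)) * f x"
      unfolding f_def of_nat_mult[symmetric] of_nat_le_iff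
      by (rule card_squared_le_card_image_mult) simp
    also have "\<dots> \<le> K * f x" using that by (intro mult_right_mono) (auto simp: f_def)
    finally show ?thesis by (simp add: e_def)
  qed
  \<comment> \<open>This includes \<open>x = 0\<close>, so the sum over the punctured lines of
    \<open>T\<close> may be enlarged to all of \<open>C\<close>.\<close>
  have g_nonneg: "g x \<ge> 0" for x
  proof -
    have "e\<^sup>2 \<le> q * f x" by (rule cs) (simp add: q_def card_mono)
    then show ?thesis using q1 by (simp add: g_def field_simps)
  qed
  have range: "V = range (\<lambda>c. c *s x)" if "V \<in> T" "x \<in> V - {0}" for V x
    using one_dimensional_eq_range line that by blast
  have g_ge: "e\<^sup>2 * (1 / N - 1 / q) \<le> g x" if "V \<in> T" "x \<in> V - {0}" for V x
  proof -
    have "e\<^sup>2 \<le> N * f x"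
      using proj[OF that(1)] by (intro cs) (simp only: card_coset_projection[OF range[OF that]])
    then show ?thesis using N q1 by (simp add: g_def field_simps)
  qed
  have punctured: "real (card (V - {0})) = q - 1" if "V \<in> T" for V
  proof -
    have "\<exists>x\<in>V. x \<noteq> 0"
    proof (rule ccontr)
      assume "\<not> (\<exists>x\<in>V. x \<noteq> 0)"
      then have "V \<subseteq> {0}" by auto
      then have "vec.dim V = 0" by (simp add: vec.dim_eq_0)
      with line[OF that] show False by simp
    qed
    then obtain x where x: "x \<in> V" "x \<noteq> 0" by blast
    then have V: "V = range (\<lambda>c. c *s x)" using range that by blast
    have "inj (\<lambda>c. c *s x)" using x(2) by (simp add: inj_on_def)
    then have "card V = CARD('a)" unfolding V by (simp add: card_image)
    moreover have "0 \<in> V" unfolding V by (rule range_eqI[of _ _ 0]) simp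
    ultimately show ?thesis using q1 by (simp add: card_Diff_subset q_def of_nat_diff)
  qed
  have disjoint: "(V - {0}) \<inter> (W - {0}) = {}" if "V \<in> T" "W \<in> T" "V \<noteq> W" for V W
    using range[OF that(1)] range[OF that(2)] that(3) by blast
  have "(q - 1) * (real (card T) * (e\<^sup>2 * (1 / N - 1 / q)))
      = (\<Sum>V\<in>T. \<Sum>x\<in>V - {0}. e\<^sup>2 * (1 / N - 1 / q))"
    by (simp add: punctured mult_ac)
  also have "\<dots> \<le> (\<Sum>V\<in>T. \<Sum>x\<in>V - {0}. g x)"
    by (intro sum_mono g_ge)
  also have "\<dots> = (\<Sum>x\<in>(\<Union>V\<in>T. V - {0}). g x)"
    using disjoint by (intro sum.UNION_disjoint[symmetric]) auto
  also have "\<dots> \<le> (\<Sum>x\<in>C. g x)"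
    using line g_nonneg by (intro sum_mono2) auto
  finally have lower: "(q - 1) * (real (card T) * (e\<^sup>2 * (1 / N - 1 / q))) \<le> (\<Sum>x\<in>C. g x)" .
  have "(\<Sum>x\<in>C. f x) = (\<Sum>x\<in>C. \<Sum>p\<in>E \<times> E. of_bool (scalar_product (fst p - snd p) x = 0))"
    by (simp add: f_def scalar_product_diff_left Int_def)
  also have "\<dots> = (\<Sum>p\<in>E \<times> E. real (card {x \<in> C. scalar_product (fst p - snd p) x = 0}))"
    by (subst sum.swap) (simp add: Int_def)
  \<comment> \<open>Multiplying by \<open>q\<close> clears \<open>e\<^sup>2 / q\<close> and
    distributes one copy of \<open>card C\<close> to each of the \<open>e\<^sup>2\<close> pairs,
    matching \<open>sections\<close> with \<open>m\<close> the difference of the pair.\<close>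
  finally have "q * (\<Sum>x\<in>C. g x)
      = (\<Sum>p\<in>E \<times> E. q * real (card {x \<in> C. scalar_product (fst p - snd p) x = 0}) - real (card C))"
    using q1 by (simp add: g_def sum_subtractf sum_distrib_left right_diff_distrib e_def
      card_cartesian_product power2_eq_square mult_ac)
  also have "\<dots> \<le> (\<Sum>p\<in>E \<times> E. (q - 1) * (q ^ (CARD('d) - 1) * of_bool (fst p - snd p = 0) + R))"
    by (intro sum_mono sections)
  \<comment> \<open>Only the \<open>e\<close> diagonal pairs have difference 0; after division by
    \<open>e\<^sup>2\<close> they yield the term with \<open>card E\<close> in the
    denominator.\<close>
  also have "\<dots> = (q - 1) * (q ^ (CARD('d) - 1) * (\<Sum>p\<in>E \<times> E. of_bool (fst p = snd p)) + R * e\<^sup>2)"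
    by (simp add: sum.distrib e_def card_cartesian_product power2_eq_square mult_ac
      flip: sum_distrib_left)
  also have "(\<Sum>p\<in>E \<times> E. of_bool (fst p = snd p)) = e"
  proof -
    have "(\<Sum>p\<in>E \<times> E. of_bool (fst p = snd p)) = (\<Sum>y\<in>E. \<Sum>z\<in>E. if y = z then 1 else (0::real))"
      unfolding sum.cartesian_product by (intro sum.cong) auto
    then show ?thesis by (simp add: e_def)
  qed
  finally have "q * (\<Sum>x\<in>C. g x) \<le> (q - 1) * (q ^ (CARD('d) - 1) * e + R * e\<^sup>2)" .
  moreover have "(q - 1) * (q * (real (card T) * (e\<^sup>2 * (1 / N - 1 / q)))) \<le> q * (\<Sum>x\<in>C. g x)"
    using mult_left_mono[OF lower, of q] q1 by (simp only: mult.left_commute)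
  ultimately have "(q - 1) * (q * (real (card T) * (e\<^sup>2 * (1 / N - 1 / q))))
      \<le> (q - 1) * (q ^ (CARD('d) - 1) * e + R * e\<^sup>2)" by linarith
  then have "q * (real (card T) * (e\<^sup>2 * (1 / N - 1 / q))) \<le> q ^ (CARD('d) - 1) * e + R * e\<^sup>2"
    using q1 by simp
  moreover have "q * (real (card T) * (e\<^sup>2 * (1 / N - 1 / q))) = real (card T) * ((q - N) * e\<^sup>2 / N)"
    using q1 N by (simp add: field_simps)
  ultimately have "real (card T) \<le> (q ^ (CARD('d) - 1) * e + R * e\<^sup>2) / ((q - N) * e\<^sup>2 / N)"
    using N e by (subst pos_le_divide_eq) auto
  also have "\<dots> = N * q ^ (CARD('d) - 1) / ((q - N) * e) + N * R / (q - N)"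
  proof -
    have "(P * e + R * e\<^sup>2) / (r * e\<^sup>2 / N) = N * P / (r * e) + N * R / r" if "r > 0" for P r
      using that N e by (simp add: field_simps power2_eq_square)
    then show ?thesis using N by simp
  qed
  finally show ?thesis by (simp add: e_def)
qed

section \<open>The cone over the section of the sphere\<close>

theorem theorem1p3:
  fixes E :: "('a::{field,finite} ^ 'd) set" and k :: 'd and lam :: 'a and N :: real
    and q d :: nat
  assumes q: "q = CARD('a)" and d: "d = CARD('d)"
    and q_odd: "odd q"
    and d_ge: "d \<ge> 3"
    and E_nonempty: "E \<noteq> {}"
    and lam: "lam \<notin> {0, 1, -1}"
    and N_pos: "0 < N" and N_less: "N < real q"
  shows
    "(odd d \<longrightarrow>
        real (card (exceptional_set (lines_through_section k lam) E N))
          \<le> N * real q ^ (d - 1) / ((real q - N) * real (card E))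
             + N * real q ^ ((d - 1) div 2) / (real q - N)) \<and>
     (even d \<and> d \<ge> 4 \<and> quadratic_character ((-1) ^ (d div 2) * (lam\<^sup>2 - 1)) = -1 \<longrightarrow>
        real (card (exceptional_set (lines_through_section k lam) E N))
          \<le> N * real q ^ (d - 1) / ((real q - N) * real (card E))
             + N * real q ^ ((d - 2) div 2) / (real q - N)) \<and>
     (even d \<and> d \<ge> 4 \<and> quadratic_character ((-1) ^ (d div 2) * (lam\<^sup>2 - 1)) = 1 \<longrightarrow>
        real (card (exceptional_set (lines_through_section k lam) E N))
          \<le> N * real q ^ (d - 1) / ((real q - N) * real (card E))
             + N * (real q ^ (d div 2) - real q ^ ((d - 2) div 2)) / (real q - N))"
proof -
  define a :: "'d \<Rightarrow> 'a" where "a i = (if i = k then 1 - 1 / lam\<^sup>2 else 1)" for i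
  define C :: "('a ^ 'd) set" where "C = {x. diagonal_form a x = 0}"
  define T where "T = exceptional_set (lines_through_section k lam) E N"
  have odd: "odd CARD('a)" using q_odd q by simp
  have lam0: "lam \<noteq> 0" and lam1: "lam\<^sup>2 \<noteq> 1" using lam by (auto simp: power2_eq_1_iff)
  \<comment> \<open>Excluding 1 and -1 for \<open>lam\<close> makes the form nondegenerate.\<close>
  have a: "a i \<noteq> 0" for i using lam0 lam1 by (simp add: a_def field_simps)
  have "diagonal_form a x = (\<Sum>i\<in>UNIV. (x $ i)\<^sup>2 - (if i = k then (x $ k)\<^sup>2 / lam\<^sup>2 else 0))" for x
    unfolding diagonal_form_def by (intro sum.cong refl) (auto simp: a_def left_diff_distrib)
  then have form: "diagonal_form a x = norm_form x - (x $ k)\<^sup>2 / lam\<^sup>2" for x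
    by (simp add: norm_form_def sum_subtractf)
  \<comment> \<open>Multiplication by the square of \<open>lam\<close> turns the product of the
    coefficients into \<open>lam\<^sup>2 - 1\<close>, so the case distinction on the form is that of
    the theorem.\<close>
  have "quadratic_character ((-1) ^ (d div 2) * (1 - 1 / lam\<^sup>2)) =
      quadratic_character (lam\<^sup>2 * ((-1) ^ (d div 2) * (1 - 1 / lam\<^sup>2)))"
    by (simp only: quadratic_character_square_mult[OF lam0])
  also have "lam\<^sup>2 * ((-1) ^ (d div 2) * (1 - 1 / lam\<^sup>2)) = (-1) ^ (d div 2) * (lam\<^sup>2 - 1)"
    using lam0 by (simp add: field_simps)
  also have "1 - 1 / lam\<^sup>2 = prod a UNIV"
    by (simp add: a_def)
  finally have eps: "quadratic_character ((-1) ^ (d div 2) * prod a UNIV) =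
      quadratic_character ((-1) ^ (d div 2) * (lam\<^sup>2 - 1))" .
  have line: "vec.subspace V \<and> vec.dim V = 1 \<and> V \<subseteq> C" if "V \<in> T" for V
  proof -
    have V: "vec.subspace V" "vec.dim V = 1"
      using that by (auto simp: T_def exceptional_set_def lines_through_section_def)
    have "\<exists>x\<in>V. x \<noteq> 0 \<and> x $ k = lam \<and> norm_form x = 1"
      using that by (simp add: T_def exceptional_set_def lines_through_section_def
        coord_plane_def unit_sphere_def)
    then obtain x where x: "x \<in> V" "x \<noteq> 0" "x $ k = lam" "norm_form x = 1" by blast
    \<comment> \<open>Both terms of the form scale by \<open>c\<^sup>2\<close>, so its zero at the
      section point spreads to the whole line.\<close>
    have "norm_form (c *s x) = c\<^sup>2" for c
      using x(4) by (simp add: norm_form_def power_mult_distrib flip: sum_distrib_left)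
    then have "c *s x \<in> C" for c
      using x(3) lam0 by (simp add: C_def form power_mult_distrib)
    then show ?thesis using V one_dimensional_eq_range[OF V x(1,2)] by auto
  qed
  \<comment> \<open>All three cases are treated at once; \<open>R\<close> is an integer so that the
    section bound can be taken over \<open>int\<close> and then cast to the reals.\<close>
  have bound: "real (card T) \<le> N * real q ^ (d - 1) / ((real q - N) * real (card E))
      + N * real_of_int R / (real q - N)"
    if R: "odd d \<and> R = int q ^ ((d - 1) div 2) \<or>
        even d \<and> quadratic_character ((-1) ^ (d div 2) * (lam\<^sup>2 - 1)) = -1 \<and> R = int q ^ ((d - 2) div 2) \<or>
        even d \<and> quadratic_character ((-1) ^ (d div 2) * (lam\<^sup>2 - 1)) = 1 \<and>
          R = int q ^ (d div 2) - int q ^ ((d - 2) div 2)" for R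
    unfolding q d
  proof (rule card_lines_in_cone_bound[OF E_nonempty N_pos _ line])
    show "N < real CARD('a)" using N_less q by simp
    show "real (card (coset_projection V E)) \<le> N" if "V \<in> T" for V
      using that by (simp add: T_def exceptional_set_def)
    fix m :: "'a ^ 'd"
    have "int q * int (card {x. diagonal_form a x = 0 \<and> scalar_product m x = 0})
        - int (card {x. diagonal_form a x = 0})
      \<le> (int q - 1) * (int q ^ (d - 1) * of_bool (m = 0) + R)"
      unfolding q d by (rule card_isotropic_section_le[OF odd a]) (use R eps in \<open>simp only: q d\<close>)
    then have "real_of_int (int q * int (card {x \<in> C. scalar_product m x = 0}) - int (card C))
      \<le> real_of_int ((int q - 1) * (int q ^ (d - 1) * of_bool (m = 0) + R))"
      by (simp only: C_def mem_Collect_eq of_int_le_iff)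
    then show "real CARD('a) * real (card {x \<in> C. scalar_product m x = 0}) - real (card C)
      \<le> (real CARD('a) - 1) * (real CARD('a) ^ (CARD('d) - 1) * of_bool (m = 0) + real_of_int R)"
      by (simp add: q d)
  qed
  show ?thesis
    using bound[of "int q ^ ((d - 1) div 2)"] bound[of "int q ^ ((d - 2) div 2)"]
      bound[of "int q ^ (d div 2) - int q ^ ((d - 2) div 2)"]
    by (auto simp: T_def)
qed

end
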